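(* Let $N\in\mathbb{N}$, $0<\mu<L$, $\sigma^2\ge 0$, $\alpha\in\left(0,\frac{2}{L+\mu}\right]$, and set $\phi=1-\mu\alpha$. Let $f:\mathbb{R}^d\to\mathbb{R}$ be a $\mu$-strongly convex and $L$-smooth function, let $x_\star$ be a minimizer of $f$, let $x_0\in\mathbb{R}^d$, and let $(x_k)_{0\le k\le N}$ be generated by $$x_{k+1}=x_k-\alpha\left(\nabla f(x_k)+\varepsilon_k\right),\qquad k=0,\dots,N-1,$$ where $\varepsilon_0,\dots,\varepsilon_{N-1}$ are $\mathbb{R}^d$-valued random variables satisfying, for all $k=0,\dots,N-1$, $$\mathbb{E}[\varepsilon_k\mid\mathcal{A}_k]=0,\qquad \mathbb{E}[\|\varepsilon_k\|^2\mid\mathcal{A}_k]\le\sigma^2 .$$ Then $$\mathbb{E}\left[\|x_N-x_\star\|^2\right]\le \phi^{2N}\|x_0-x_\star\|^2+\frac{1-\phi^{2N}}{1-\phi^2}\,\alpha^2\sigma^2 .$$ In addition, this bound is tight: for all $N\in\mathbb{N}$, $0<\mu<L$, $\sigma^2\ge 0$, $\alpha\in\left(0,\frac{2}{L+\mu}\right]$ and every starting point $x_0\in\mathbb{R}^d$ ($d\ge1$), there exist a $\mu$-strongly convex $L$-smooth function $f:\mathbb{R}^d\to\mathbb{R}$ with minimizer $x_\star$ and $\mathbb{R}^d$-valued random variables $\varepsilon_0,\dots,\varepsilon_{N-1}$ satisfying $\mathbb{E}[\varepsilon_k\mid\mathcal{A}_k]=0$ and $\mathbb{E}[\|\varepsilon_k\|^2\mid\mathcal{A}_k]\le\sigma^2$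 for all $k=0,\dots,N-1$, such that the iterates $x_{k+1}=x_k-\alpha\left(\nabla f(x_k)+\varepsilon_k\right)$, $k=0,\dots,N-1$, satisfy $$\mathbb{E}\left[\|x_N-x_\star\|^2\right]= \phi^{2N}\|x_0-x_\star\|^2+\frac{1-\phi^{2N}}{1-\phi^2}\,\alpha^2\sigma^2 .$$
   Context: $\mathbb{R}^d$ carries the standard inner product and its induced norm $\|\cdot\|$. A function $f$ is $\mu$-strongly convex if $f-\frac{\mu}{2}\|\cdot\|^2$ is convex, and $L$-smooth if it is differentiable everywhere with $L$-Lipschitz continuous gradient. The starting point $x_0$ and the minimizer $x_\star$ are deterministic. $\mathcal{A}_k=\sigma(x_0,\ldots,x_k,\varepsilon_0,\ldots,\varepsilon_{k-1})$ is the $\sigma$-algebra of information available at iteration $k$. $\mathbb{E}[\cdot]$ is the expectation over the joint distribution of all random variables involved. A bound is called tight when it is attained by a specific function under a specific noise distribution. *)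

theory Defs
  imports "HOL-Probability.Probability"
begin

definition gradient :: "('a::real_inner \<Rightarrow> real) \<Rightarrow> 'a \<Rightarrow> 'a" where
  "gradient f x = (THE g. GDERIV f x :> g)"

definition strongly_convex :: "real \<Rightarrow> ('a::real_inner \<Rightarrow> real) \<Rightarrow> bool" where
  "strongly_convex \<mu> f \<longleftrightarrow> convex_on UNIV (\<lambda>x. f x - \<mu> / 2 * (norm x)\<^sup>2)"

definition smooth :: "real \<Rightarrow> ('a::real_inner \<Rightarrow> real) \<Rightarrow> bool" where
  "smooth L f \<longleftrightarrow> (\<forall>x. f differentiable (at x)) \<and> L-lipschitz_on UNIV (gradient f)"

primrec sgd ::
  "('a::real_inner \<Rightarrow> real) \<Rightarrow> real \<Rightarrow> 'a \<Rightarrow> (nat \<Rightarrow> 'w \<Rightarrow> 'a) \<Rightarrow> nat \<Rightarrow> 'w \<Rightarrow> 'a"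
where
  "sgd f \<alpha> x0 \<epsilon> 0 = (\<lambda>\<omega>. x0)"
| "sgd f \<alpha> x0 \<epsilon> (Suc k) =
     (\<lambda>\<omega>. sgd f \<alpha> x0 \<epsilon> k \<omega> - \<alpha> *\<^sub>R (gradient f (sgd f \<alpha> x0 \<epsilon> k \<omega>) + \<epsilon> k \<omega>))"

text \<open>
  The sigma-algebra generated by \<open>x 0, \<dots>, x k, \<epsilon> 0, \<dots>, \<epsilon> (k - 1)\<close>. Only its space and its
  measurable sets matter; the measure it carries is not used.
\<close>

definition history ::
  "'w measure \<Rightarrow> (nat \<Rightarrow> 'w \<Rightarrow> 'a::topological_space) \<Rightarrow> (nat \<Rightarrow> 'w \<Rightarrow> 'a) \<Rightarrow> nat \<Rightarrow> 'w measure"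
where
  "history M x \<epsilon> k = sigma (space M)
     ({x i -` B \<inter> space M | i B. i \<le> k \<and> B \<in> sets borel} \<union>
      {\<epsilon> i -` B \<inter> space M | i B. i < k \<and> B \<in> sets borel})"

text \<open>The library has conditional expectations of real functions only; vectors are treated
  componentwise.\<close>

definition vec_cond_exp ::
  "'w measure \<Rightarrow> 'w measure \<Rightarrow> ('w \<Rightarrow> real ^ 'd) \<Rightarrow> 'w \<Rightarrow> real ^ 'd"
where
  "vec_cond_exp M F X = (\<lambda>\<omega>. \<chi> j. real_cond_exp M F (\<lambda>\<omega>'. X \<omega>' $ j) \<omega>)"

text \<open>
  The conditional second moment is the extended nonnegative one, so that the bound on it entails
  that \<open>\<epsilon> k\<close> is square integrable. In particular \<open>\<epsilon> k\<close> is integrable, and \<open>real_cond_exp\<close> is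
  then the genuine conditional expectation.
\<close>

definition sgd_noise ::
  "'w measure \<Rightarrow> nat \<Rightarrow> (real ^ 'd \<Rightarrow> real) \<Rightarrow> real \<Rightarrow> real ^ 'd \<Rightarrow> real \<Rightarrow> (nat \<Rightarrow> 'w \<Rightarrow> real ^ 'd) \<Rightarrow> bool"
where
  "sgd_noise M N f \<alpha> x0 \<sigma> \<epsilon> \<longleftrightarrow>
     (\<forall>k<N. \<epsilon> k \<in> borel_measurable M \<and>
       (AE \<omega> in M. vec_cond_exp M (history M (sgd f \<alpha> x0 \<epsilon>) \<epsilon> k) (\<epsilon> k) \<omega> = 0) \<and>
       (AE \<omega> in M. nn_cond_exp M (history M (sgd f \<alpha> x0 \<epsilon>) \<epsilon> k)
                      (\<lambda>\<omega>'. ennreal ((norm (\<epsilon> k \<omega>'))\<^sup>2)) \<omega> \<le> ennreal (\<sigma>\<^sup>2)))"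

end

theory Submission
  imports Defs
begin

text \<open>
  The distance to the minimizer contracts in each gradient step: for \<open>\<alpha> \<le> 2 / (L + \<mu>)\<close>, the map
  \<open>x \<mapsto> x - \<alpha> *\<^sub>R gradient f x\<close> shrinks the squared distance to \<open>xstar\<close> by the factor \<open>\<phi>\<^sup>2\<close>
  (\<open>gradient_step_contraction\<close>). This rests on the cocoercivity of the gradient of the convex
  function \<open>f - \<mu> / 2 * norm\<^sup>2\<close> with constant \<open>L - \<mu>\<close>, and on the gradient vanishing at \<open>xstar\<close>.

  The noise of step \<open>k\<close> is conditionally centered given the history, and the gradient step taken
  from \<open>x\<^sub>k\<close> is a function of the history. The cross term between the two therefore vanishes in
  expectation (\<open>second_moment_add_cond_centered\<close>), and the second moments
  \<open>a\<^sub>k = E (norm (x\<^sub>k - xstar))\<^sup>2\<close> satisfy \<open>a\<^sub>k\<^sub>+\<^sub>1 \<le> \<phi>\<^sup>2 * a\<^sub>k + \<alpha>\<^sup>2 * \<sigma>\<^sup>2\<close>. Unrolling this recursion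
  produces the geometric sum in the bound.

  Only two inequalities enter, the contraction and the bound on the noise. They are equalities when
  the gradient step is the scaling by \<open>\<phi>\<close> about \<open>xstar\<close> and the noise has second moment \<open>\<sigma>\<^sup>2\<close>. The first happens for
  \<open>f x = \<mu> / 2 * (norm x)\<^sup>2\<close>, the second for independent uniform signs times a vector of norm
  \<open>\<bar>\<sigma>\<bar>\<close>. That these signs are centered given the history follows from a symmetry: changing the
  sign of entry \<open>k\<close> preserves the uniform distribution on the finite set of sign sequences as well
  as all events known before step \<open>k\<close>.
\<close>

section \<open>Gradients\<close>

lemma GDERIV_gradientI:
  assumes "GDERIV f x :> g"
  shows "gradient f x = g"
  unfolding gradient_def
proof (rule the_equality)
  show "GDERIV f x :> g"
    by fact
next
  fix g' assume "GDERIV f x :> g'"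
  then have "(\<lambda>h. inner h g') = (\<lambda>h. inner h g)"
    using assms unfolding gderiv_def by (rule has_derivative_unique)
  then show "g' = g"
    by (metis inner_commute vector_eq_rdot)
qed

lemma GDERIV_gradient:
  fixes f :: "'a::euclidean_space \<Rightarrow> real"
  assumes "f differentiable (at x)"
  shows "GDERIV f x :> gradient f x"
proof -
  obtain f' where f': "(f has_derivative f') (at x)"
    using assms unfolding differentiable_def by blast
  interpret linear f'
    using f' by (rule has_derivative_linear)
  \<comment> \<open>the Riesz representative of the derivative\<close>
  define g where "g = (\<Sum>b\<in>Basis. f' b *\<^sub>R b)"
  have "f' h = inner h g" for h
  proof -
    have "f' h = f' (\<Sum>b\<in>Basis. inner h b *\<^sub>R b)"
      by (simp add: euclidean_representation)
    also have "\<dots> = (\<Sum>b\<in>Basis. inner h b * f' b)"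
      by (simp add: sum scale)
    also have "\<dots> = inner h g"
      unfolding g_def by (simp add: inner_sum_right mult.commute)
    finally show ?thesis .
  qed
  then have "f' = (\<lambda>h. inner h g)"
    by auto
  then have "GDERIV f x :> g"
    using f' unfolding gderiv_def by simp
  then show ?thesis
    using GDERIV_gradientI by metis
qed

lemma GDERIV_half_norm_square: "GDERIV (\<lambda>x. c / 2 * (norm x)\<^sup>2) x :> c *\<^sub>R x"
  unfolding gderiv_def power2_norm_eq_inner
  by (auto intro!: derivative_eq_intros simp: inner_commute)

lemma GDERIV_along_line:
  assumes "GDERIV f (x + t *\<^sub>R d) :> g"
  shows "((\<lambda>t. f (x + t *\<^sub>R d)) has_field_derivative inner d g) (at t)"
proof -
  have "((\<lambda>t. x + t *\<^sub>R d) has_derivative (\<lambda>s. s *\<^sub>R d)) (at t)"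
    by (auto intro!: derivative_eq_intros)
  from has_derivative_compose[OF this assms[unfolded gderiv_def]]
  show ?thesis
    by (simp add: has_field_derivative_def mult_commute_abs)
qed

lemma GDERIV_minimizer_zero:
  assumes "GDERIV f x :> g" and "\<forall>y. f x \<le> f y"
  shows "g = 0"
proof -
  have "(\<lambda>h. inner h g) = (\<lambda>h. 0)"
    by (rule differential_zero_maxmin[where S = UNIV and x = x and f = f])
       (use assms in \<open>auto simp: gderiv_def\<close>)
  then show ?thesis
    by (metis inner_eq_zero_iff)
qed

lemma convex_on_tangent_le:
  fixes h :: "'a::real_inner \<Rightarrow> real"
  assumes h: "convex_on UNIV h" and g: "GDERIV h x :> g"
  shows "h x + inner (y - x) g \<le> h y"
proof -
  define q where "q = (\<lambda>t::real. h (x + t *\<^sub>R (y - x)))"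
  have "convex_on UNIV q"
  proof (rule convex_onI)
    fix t a b :: real assume t: "0 < t" "t < 1"
    have "x + ((1 - t) *\<^sub>R a + t *\<^sub>R b) *\<^sub>R (y - x)
        = (1 - t) *\<^sub>R (x + a *\<^sub>R (y - x)) + t *\<^sub>R (x + b *\<^sub>R (y - x))"
      by (simp add: algebra_simps)
    then show "q ((1 - t) *\<^sub>R a + t *\<^sub>R b) \<le> (1 - t) * q a + t * q b"
      unfolding q_def using convex_onD[OF h, of t] t by simp
  qed simp
  moreover have "(q has_field_derivative inner (y - x) g) (at 0)"
    unfolding q_def by (rule GDERIV_along_line) (use g in simp)
  ultimately have "inner (y - x) g * (1 - 0) \<le> q 1 - q 0"
    by (intro convex_on_imp_above_tangent[where A = UNIV]) auto
  then show ?thesis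
    by (simp add: q_def)
qed

text \<open>
  Along the segment from \<open>x\<close> to \<open>y\<close> the slope of \<open>f\<close> exceeds its initial value after time \<open>t\<close> by at
  most \<open>L * t * norm (y - x)\<^sup>2\<close>; comparing with the primitive of this bound gives the quadratic.
\<close>

lemma lipschitz_gradient_quadratic_upper_bound:
  fixes f :: "'a::real_inner \<Rightarrow> real"
  assumes G: "\<And>x. GDERIV f x :> G x" and L: "L-lipschitz_on UNIV G"
  shows "f y \<le> f x + inner (y - x) (G x) + L / 2 * (norm (y - x))\<^sup>2"
proof -
  define d where "d = y - x"
  define q where "q = (\<lambda>t. f (x + t *\<^sub>R d) - t * inner d (G x) - L / 2 * t\<^sup>2 * (norm d)\<^sup>2)"
  have "q 1 \<le> q 0"
  proof (rule DERIV_nonpos_imp_nonincreasing[where f = q])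
    fix t :: real assume t: "0 \<le> t" "t \<le> 1"
    let ?D = "inner d (G (x + t *\<^sub>R d)) - inner d (G x) - L * t * (norm d)\<^sup>2"
    have "(q has_field_derivative ?D) (at t)"
      unfolding q_def
      by (rule derivative_eq_intros GDERIV_along_line[OF G] refl | simp)+
    moreover have "?D \<le> 0"
    proof -
      have "inner d (G (x + t *\<^sub>R d) - G x) \<le> norm d * norm (G (x + t *\<^sub>R d) - G x)"
        by (rule norm_cauchy_schwarz)
      also have "\<dots> \<le> norm d * (L * norm (t *\<^sub>R d))"
        using lipschitz_onD[OF L, of "x + t *\<^sub>R d" x]
        by (intro mult_left_mono) (auto simp: dist_norm)
      also have "\<dots> = L * t * (norm d)\<^sup>2"
        using t by (simp add: power2_eq_square)
      finally show ?thesis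
        by (simp add: inner_diff_right)
    qed
    ultimately show "\<exists>D. (q has_field_derivative D) (at t) \<and> D \<le> 0"
      by blast
  qed simp
  then show ?thesis
    by (simp add: q_def d_def)
qed

section \<open>Contraction of a gradient step towards the minimizer\<close>

text \<open>
  The tangent at \<open>x\<close> lies below the graph, and the quadratic at \<open>y\<close> lies above it. Comparing the
  two at the minimum over \<open>z\<close> of the quadratic minus the tangent gives the sharpest inequality.
\<close>

lemma convex_lower_bound_by_gradient_difference:
  fixes h :: "'a::real_inner \<Rightarrow> real"
  assumes h: "convex_on UNIV h" and G: "\<And>x. GDERIV h x :> G x" and "K > 0"
    and upper: "\<And>x y. h y \<le> h x + inner (y - x) (G x) + K / 2 * (norm (y - x))\<^sup>2"
  shows "h x + inner (y - x) (G x) + (norm (G y - G x))\<^sup>2 / (2 * K) \<le> h y"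
proof -
  define D where "D = G y - G x"
  define z where "z = y - (1 / K) *\<^sub>R D"
  have "h x + inner (z - x) (G x) \<le> h y + inner (z - y) (G y) + K / 2 * (norm (z - y))\<^sup>2"
    using convex_on_tangent_le[OF h G, of x z] upper[of z y] by linarith
  moreover have "inner (z - x) (G x) = inner (y - x) (G x) - inner D (G x) / K"
    by (simp add: z_def inner_diff_left inner_diff_right)
  moreover have "inner (z - y) (G y) = - inner D (G y) / K"
    by (simp add: z_def)
  moreover have "K / 2 * (norm (z - y))\<^sup>2 = (norm D)\<^sup>2 / (2 * K)"
    using \<open>K > 0\<close> by (simp add: z_def power_divide power2_eq_square)
  moreover have "(norm D)\<^sup>2 / K = inner D (G y) / K - inner D (G x) / K"
    by (simp add: power2_norm_eq_inner D_def inner_diff_left inner_diff_right diff_divide_distrib)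
  ultimately show ?thesis
    unfolding D_def[symmetric] by (simp add: field_simps)
qed

lemma convex_gradient_cocoercive:
  fixes h :: "'a::real_inner \<Rightarrow> real"
  assumes "convex_on UNIV h" "\<And>x. GDERIV h x :> G x" "K > 0"
    and "\<And>x y. h y \<le> h x + inner (y - x) (G x) + K / 2 * (norm (y - x))\<^sup>2"
  shows "(norm (G y - G x))\<^sup>2 \<le> K * inner (y - x) (G y - G x)"
proof -
  have "(norm (G y - G x))\<^sup>2 / (2 * K) + (norm (G x - G y))\<^sup>2 / (2 * K)
      \<le> - inner (y - x) (G x) - inner (x - y) (G y)"
    using convex_lower_bound_by_gradient_difference[OF assms, of x y]
      convex_lower_bound_by_gradient_difference[OF assms, of y x] by linarith
  also have "- inner (y - x) (G x) - inner (x - y) (G y) = inner (y - x) (G y - G x)"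
    by (simp add: algebra_simps)
  finally show ?thesis
    using \<open>K > 0\<close> by (simp add: norm_minus_commute field_simps)
qed

text \<open>
  Removing the convex quadratic \<open>\<mu> / 2 * norm\<^sup>2\<close> from \<open>f\<close> leaves a convex function whose quadratic
  upper bound has curvature \<open>L - \<mu>\<close>, so that the cocoercivity of its gradient uses both constants
  at once.
\<close>

lemma strongly_convex_smooth_coercive:
  fixes f :: "'a::euclidean_space \<Rightarrow> real"
  assumes "\<mu> < L" and sc: "strongly_convex \<mu> f" and sm: "smooth L f"
  shows "(norm (gradient f y - gradient f x - \<mu> *\<^sub>R (y - x)))\<^sup>2
      \<le> (L - \<mu>) * inner (y - x) (gradient f y - gradient f x - \<mu> *\<^sub>R (y - x))"
proof -
  let ?h = "\<lambda>x. f x - \<mu> / 2 * (norm x)\<^sup>2" and ?G = "\<lambda>x. gradient f x - \<mu> *\<^sub>R x"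
  have grad: "GDERIV f x :> gradient f x" for x
    using sm by (intro GDERIV_gradient) (simp add: smooth_def)
  have "(norm (?G y - ?G x))\<^sup>2 \<le> (L - \<mu>) * inner (y - x) (?G y - ?G x)"
  proof (rule convex_gradient_cocoercive)
    show "convex_on UNIV ?h"
      using sc by (simp add: strongly_convex_def)
    show "GDERIV ?h x :> ?G x" for x
      by (intro GDERIV_diff grad GDERIV_half_norm_square)
    show "?h y \<le> ?h x + inner (y - x) (?G x) + (L - \<mu>) / 2 * (norm (y - x))\<^sup>2" for x y
    proof -
      have "f y \<le> f x + inner (y - x) (gradient f x) + L / 2 * (norm (y - x))\<^sup>2"
        by (rule lipschitz_gradient_quadratic_upper_bound[OF grad])
           (use sm in \<open>simp add: smooth_def\<close>)
      moreover have "\<mu> / 2 * (norm y)\<^sup>2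
          = \<mu> / 2 * (norm x)\<^sup>2 + \<mu> * inner (y - x) x + \<mu> / 2 * (norm (y - x))\<^sup>2"
        by (simp add: power2_norm_eq_inner inner_diff_left inner_diff_right inner_commute
            field_simps)
      ultimately show ?thesis
        by (simp add: inner_diff_right field_simps)
    qed
  qed (use \<open>\<mu> < L\<close> in simp)
  then show ?thesis
    by (simp add: algebra_simps)
qed

text \<open>
  With \<open>g\<close> the gradient at \<open>x\<close> and \<open>d = x - xstar\<close>, coercivity reads
  \<open>(L + \<mu>) * inner g d \<ge> norm g ^ 2 + \<mu> * L * norm d ^ 2\<close>. Substituting it into the expansion of
  the squared distance leaves \<open>norm g ^ 2\<close> with the coefficient \<open>\<alpha> * (\<alpha> - 2 / (L + \<mu>))\<close>, which
  the step size condition makes nonpositive; the bound \<open>norm g \<ge> \<mu> * norm d\<close> then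
  gives exactly the factor \<open>(1 - \<mu> * \<alpha>)\<^sup>2\<close>.
\<close>

lemma gradient_step_contraction:
  fixes f :: "'a::euclidean_space \<Rightarrow> real"
  assumes \<mu>: "0 < \<mu>" "\<mu> < L" and \<alpha>: "0 < \<alpha>" "\<alpha> \<le> 2 / (L + \<mu>)"
    and sc: "strongly_convex \<mu> f" and sm: "smooth L f" and min: "\<forall>y. f xstar \<le> f y"
  shows "(norm (x - \<alpha> *\<^sub>R gradient f x - xstar))\<^sup>2 \<le> (1 - \<mu> * \<alpha>)\<^sup>2 * (norm (x - xstar))\<^sup>2"
proof -
  define d g where "d = x - xstar" and "g = gradient f x"
  define D G I where "D = (norm d)\<^sup>2" and "G = (norm g)\<^sup>2" and "I = inner d g"
  have "gradient f xstar = 0"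
    using GDERIV_minimizer_zero[OF GDERIV_gradient min] sm by (simp add: smooth_def)
  then have coco: "(norm (g - \<mu> *\<^sub>R d))\<^sup>2 \<le> (L - \<mu>) * inner d (g - \<mu> *\<^sub>R d)"
    using strongly_convex_smooth_coercive[OF \<mu>(2) sc sm, of x xstar] by (simp add: d_def g_def)
  have inner_eq: "inner d (g - \<mu> *\<^sub>R d) = I - \<mu> * D"
    by (simp add: inner_diff_right I_def D_def power2_norm_eq_inner)
  have norm_eq: "(norm (g - \<mu> *\<^sub>R d))\<^sup>2 = G - 2 * \<mu> * I + \<mu>\<^sup>2 * D"
    by (simp add: I_def D_def G_def power2_norm_eq_inner inner_diff_left inner_diff_right
        inner_commute algebra_simps power2_eq_square[of \<mu>])
  have coercive: "G + \<mu> * L * D \<le> (L + \<mu>) * I"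
    using coco[unfolded inner_eq norm_eq] by (simp add: algebra_simps power2_eq_square)
  have "0 \<le> (L - \<mu>) * (I - \<mu> * D)"
    using order_trans[OF zero_le_power2 coco] by (simp only: inner_eq)
  then have I_lower: "\<mu> * D \<le> I"
    using \<mu> by (simp add: zero_le_mult_iff)
  have "\<mu> * (norm d)\<^sup>2 \<le> norm d * norm g"
    using I_lower norm_cauchy_schwarz[of d g] unfolding I_def D_def by linarith
  then have "\<mu> * norm d \<le> norm g"
    by (cases "d = 0") (simp_all add: power2_eq_square)
  then have "(\<mu> * norm d)\<^sup>2 \<le> G"
    unfolding G_def using \<mu> by (intro power_mono) auto
  then have G_lower: "\<mu>\<^sup>2 * D \<le> G"
    by (simp add: power_mult_distrib D_def)
  have step_eq: "x - \<alpha> *\<^sub>R gradient f x - xstar = d - \<alpha> *\<^sub>R g"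
    by (simp add: d_def g_def)
  have "(norm (d - \<alpha> *\<^sub>R g))\<^sup>2 = D - 2 * \<alpha> * I + \<alpha>\<^sup>2 * G"
    by (simp add: I_def D_def G_def power2_norm_eq_inner inner_diff_left inner_diff_right
        inner_commute algebra_simps power2_eq_square[of \<alpha>])
  moreover have "(L + \<mu>) * (D - 2 * \<alpha> * I + \<alpha>\<^sup>2 * G) \<le> (L + \<mu>) * ((1 - \<mu> * \<alpha>)\<^sup>2 * D)"
  proof -
    have "(2 * \<alpha>) * (G + \<mu> * L * D) \<le> (2 * \<alpha>) * ((L + \<mu>) * I)"
      using coercive \<alpha> by (intro mult_left_mono) auto
    moreover have "(L + \<mu>) * \<alpha> \<le> 2"
      using \<alpha> \<mu> by (simp add: field_simps)
    then have "\<alpha> * (2 - (L + \<mu>) * \<alpha>) * (\<mu>\<^sup>2 * D) \<le> \<alpha> * (2 - (L + \<mu>) * \<alpha>) * G"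
      using \<alpha> by (intro mult_left_mono G_lower mult_nonneg_nonneg) auto
    ultimately show ?thesis
      by (simp add: algebra_simps power2_eq_square)
  qed
  ultimately show ?thesis
    unfolding step_eq using \<mu> by (simp add: D_def d_def)
qed

section \<open>One step of the second moment\<close>

lemma integrable_of_nn_cond_exp_le:
  fixes e :: "'w \<Rightarrow> 'a::{real_normed_vector, second_countable_topology}"
  assumes M: "prob_space M" and F: "subalgebra M F" and [measurable]: "e \<in> borel_measurable M"
    and "0 \<le> s"
    and bound: "AE \<omega> in M. nn_cond_exp M F (\<lambda>\<omega>. ennreal ((norm (e \<omega>))\<^sup>2)) \<omega> \<le> ennreal s"
  shows "integrable M (\<lambda>\<omega>. (norm (e \<omega>))\<^sup>2)"
    and "prob_space.expectation M (\<lambda>\<omega>. (norm (e \<omega>))\<^sup>2) \<le> s"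
proof -
  interpret prob_space M by fact
  interpret finite_measure_subalgebra M F
    by unfold_locales (rule F)
  have "(\<integral>\<^sup>+\<omega>. ennreal ((norm (e \<omega>))\<^sup>2) \<partial>M)
      = (\<integral>\<^sup>+\<omega>. nn_cond_exp M F (\<lambda>\<omega>. ennreal ((norm (e \<omega>))\<^sup>2)) \<omega> \<partial>M)"
    using nn_cond_exp_intg[of "\<lambda>_. 1" "\<lambda>\<omega>. ennreal ((norm (e \<omega>))\<^sup>2)"] by simp
  also have "\<dots> \<le> (\<integral>\<^sup>+\<omega>. ennreal s \<partial>M)"
    by (rule nn_integral_mono_AE[OF bound])
  finally have le: "(\<integral>\<^sup>+\<omega>. ennreal ((norm (e \<omega>))\<^sup>2) \<partial>M) \<le> ennreal s"
    by (simp add: emeasure_space_1)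
  then show int: "integrable M (\<lambda>\<omega>. (norm (e \<omega>))\<^sup>2)"
    by (intro integrableI_bounded) (auto intro: le_less_trans)
  show "expectation (\<lambda>\<omega>. (norm (e \<omega>))\<^sup>2) \<le> s"
    using le \<open>0 \<le> s\<close> by (simp add: nn_integral_eq_integral[OF int])
qed

lemma integrable_component_mult:
  fixes u e :: "'w \<Rightarrow> real ^ 'd"
  assumes [measurable]: "u \<in> borel_measurable M" "e \<in> borel_measurable M"
    and "integrable M (\<lambda>\<omega>. (norm (u \<omega>))\<^sup>2)" "integrable M (\<lambda>\<omega>. (norm (e \<omega>))\<^sup>2)"
  shows "integrable M (\<lambda>\<omega>. u \<omega> $ j * e \<omega> $ j)"
proof (rule Bochner_Integration.integrable_bound)
  show "integrable M (\<lambda>\<omega>. (norm (u \<omega>))\<^sup>2 + (norm (e \<omega>))\<^sup>2)"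
    using assms by simp
  show "AE \<omega> in M. norm (u \<omega> $ j * e \<omega> $ j) \<le> norm ((norm (u \<omega>))\<^sup>2 + (norm (e \<omega>))\<^sup>2)"
  proof (rule AE_I2)
    fix \<omega>
    have "\<bar>u \<omega> $ j\<bar> * \<bar>e \<omega> $ j\<bar> \<le> norm (u \<omega>) * norm (e \<omega>)"
      by (intro mult_mono component_le_norm_cart) auto
    also have "\<dots> \<le> (norm (u \<omega>))\<^sup>2 + (norm (e \<omega>))\<^sup>2"
      using sum_squares_bound[of "norm (u \<omega>)" "norm (e \<omega>)"]
        mult_nonneg_nonneg[OF norm_ge_zero[of "u \<omega>"] norm_ge_zero[of "e \<omega>"]]
      unfolding mult.assoc by linarith
    finally show "norm (u \<omega> $ j * e \<omega> $ j) \<le> norm ((norm (u \<omega>))\<^sup>2 + (norm (e \<omega>))\<^sup>2)"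
      by (simp add: abs_mult)
  qed
qed (intro borel_measurable_times measurable_compose[OF _ borel_measurable_nth] assms(1,2))

text \<open>
  A square-integrable vector known to \<open>F\<close> is orthogonal in \<open>L\<^sup>2\<close> to a vector whose conditional
  expectation given \<open>F\<close> vanishes, so the squared norms add.
\<close>

lemma second_moment_add_cond_centered:
  fixes u e :: "'w \<Rightarrow> real ^ 'd"
  assumes M: "prob_space M" and F: "subalgebra M F"
    and u[measurable]: "u \<in> borel_measurable F" and e[measurable]: "e \<in> borel_measurable M"
    and u2: "integrable M (\<lambda>\<omega>. (norm (u \<omega>))\<^sup>2)" and e2: "integrable M (\<lambda>\<omega>. (norm (e \<omega>))\<^sup>2)"
    and centered: "AE \<omega> in M. vec_cond_exp M F e \<omega> = 0"
  shows "integrable M (\<lambda>\<omega>. (norm (u \<omega> - \<alpha> *\<^sub>R e \<omega>))\<^sup>2)"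
    and "prob_space.expectation M (\<lambda>\<omega>. (norm (u \<omega> - \<alpha> *\<^sub>R e \<omega>))\<^sup>2)
      = prob_space.expectation M (\<lambda>\<omega>. (norm (u \<omega>))\<^sup>2)
        + \<alpha>\<^sup>2 * prob_space.expectation M (\<lambda>\<omega>. (norm (e \<omega>))\<^sup>2)"
proof -
  interpret prob_space M by fact
  interpret finite_measure_subalgebra M F
    by unfold_locales (rule F)
  have uM: "u \<in> borel_measurable M"
    using F u by (rule measurable_from_subalg)
  have int: "integrable M (\<lambda>\<omega>. u \<omega> $ j * e \<omega> $ j)" for j
    using uM e u2 e2 by (rule integrable_component_mult)
  have [measurable]: "(\<lambda>\<omega>. u \<omega> $ j) \<in> borel_measurable F" "(\<lambda>\<omega>. e \<omega> $ j) \<in> borel_measurable M" for j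
    using u e by (auto intro: measurable_compose[OF _ borel_measurable_nth])
  have zero: "expectation (\<lambda>\<omega>. u \<omega> $ j * e \<omega> $ j) = 0" for j
  proof -
    have "expectation (\<lambda>\<omega>. u \<omega> $ j * e \<omega> $ j)
        = expectation (\<lambda>\<omega>. u \<omega> $ j * real_cond_exp M F (\<lambda>\<omega>. e \<omega> $ j) \<omega>)"
      by (rule real_cond_exp_intg(2)[OF int, symmetric]) measurable
    also have "\<dots> = expectation (\<lambda>\<omega>. 0)"
    proof (rule integral_cong_AE)
      show "AE \<omega> in M. u \<omega> $ j * real_cond_exp M F (\<lambda>\<omega>. e \<omega> $ j) \<omega> = 0"
        using centered by eventually_elim (simp add: vec_cond_exp_def vec_eq_iff)
    qed (auto intro!: borel_measurable_times measurable_from_subalg[OF F])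
    finally show ?thesis
      by simp
  qed
  have int_inner: "integrable M (\<lambda>\<omega>. inner (u \<omega>) (e \<omega>))"
    unfolding inner_vec_def using int by simp
  have zero_inner: "expectation (\<lambda>\<omega>. inner (u \<omega>) (e \<omega>)) = 0"
    unfolding inner_vec_def using int zero by simp
  have expand: "(norm (u \<omega> - \<alpha> *\<^sub>R e \<omega>))\<^sup>2
      = (norm (u \<omega>))\<^sup>2 + \<alpha>\<^sup>2 * (norm (e \<omega>))\<^sup>2 - 2 * \<alpha> * inner (u \<omega>) (e \<omega>)" for \<omega>
    by (simp add: power2_norm_eq_inner inner_diff_left inner_diff_right inner_commute
        algebra_simps power2_eq_square[of \<alpha>])
  show "integrable M (\<lambda>\<omega>. (norm (u \<omega> - \<alpha> *\<^sub>R e \<omega>))\<^sup>2)"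
    unfolding expand using u2 e2 int_inner by simp
  show "expectation (\<lambda>\<omega>. (norm (u \<omega> - \<alpha> *\<^sub>R e \<omega>))\<^sup>2)
      = expectation (\<lambda>\<omega>. (norm (u \<omega>))\<^sup>2) + \<alpha>\<^sup>2 * expectation (\<lambda>\<omega>. (norm (e \<omega>))\<^sup>2)"
    unfolding expand using u2 e2 int_inner zero_inner by simp
qed

section \<open>The stochastic iteration\<close>

lemma smooth_gradient_measurable:
  assumes "smooth L f"
  shows "gradient f \<in> borel_measurable borel"
  using assms unfolding smooth_def
  by (auto intro!: borel_measurable_continuous_onI lipschitz_on_continuous_on)

lemma sgd_measurable:
  fixes f :: "real ^ 'd \<Rightarrow> real"
  assumes [measurable]: "gradient f \<in> borel_measurable borel"
    and "\<And>i. i < k \<Longrightarrow> \<epsilon> i \<in> borel_measurable M"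
  shows "sgd f \<alpha> x0 \<epsilon> k \<in> borel_measurable M"
  using assms(2)
proof (induction k)
  case (Suc k)
  then have [measurable]: "sgd f \<alpha> x0 \<epsilon> k \<in> borel_measurable M" "\<epsilon> k \<in> borel_measurable M"
    by auto
  show ?case
    by simp
qed simp

lemma history_generators_subset:
  "{x i -` B \<inter> space M | i B. i \<le> k \<and> B \<in> sets borel} \<union>
   {\<epsilon> i -` B \<inter> space M | i B. i < k \<and> B \<in> sets borel} \<subseteq> Pow (space M)"
  by auto

lemma history_subalgebra:
  fixes x \<epsilon> :: "nat \<Rightarrow> 'w \<Rightarrow> 'a::topological_space"
  assumes x: "\<And>i. i \<le> k \<Longrightarrow> x i \<in> borel_measurable M"
    and \<epsilon>: "\<And>i. i < k \<Longrightarrow> \<epsilon> i \<in> borel_measurable M"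
  shows "subalgebra M (history M x \<epsilon> k)"
  unfolding subalgebra_def history_def
    space_measure_of[OF history_generators_subset] sets_measure_of[OF history_generators_subset]
  by (intro conjI refl sets.sigma_sets_subset) (auto intro: measurable_sets x \<epsilon>)

lemma iterate_history_measurable:
  fixes x \<epsilon> :: "nat \<Rightarrow> 'w \<Rightarrow> 'a::topological_space"
  shows "x k \<in> borel_measurable (history M x \<epsilon> k)"
proof (rule measurableI)
  fix B :: "'a set" assume "B \<in> sets borel"
  then show "x k -` B \<inter> space (history M x \<epsilon> k) \<in> sets (history M x \<epsilon> k)"
    unfolding history_def
      space_measure_of[OF history_generators_subset] sets_measure_of[OF history_generators_subset]
    by (intro sigma_sets.Basic) auto
qed simp

lemma sgd_noiseD:
  fixes f :: "real ^ 'd \<Rightarrow> real"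
  assumes M: "prob_space M" and grad: "gradient f \<in> borel_measurable borel"
    and noise: "sgd_noise M N f \<alpha> x0 \<sigma> \<epsilon>" and k: "k < N"
  shows "subalgebra M (history M (sgd f \<alpha> x0 \<epsilon>) \<epsilon> k)"
    and "integrable M (\<lambda>\<omega>. (norm (\<epsilon> k \<omega>))\<^sup>2)"
    and "prob_space.expectation M (\<lambda>\<omega>. (norm (\<epsilon> k \<omega>))\<^sup>2) \<le> \<sigma>\<^sup>2"
proof -
  have meas: "\<epsilon> i \<in> borel_measurable M" if "i < N" for i
    using noise that by (simp add: sgd_noise_def)
  show F: "subalgebra M (history M (sgd f \<alpha> x0 \<epsilon>) \<epsilon> k)"
    using k by (intro history_subalgebra sgd_measurable grad meas) auto
  have bound: "AE \<omega> in M. nn_cond_exp M (history M (sgd f \<alpha> x0 \<epsilon>) \<epsilon> k)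
      (\<lambda>\<omega>. ennreal ((norm (\<epsilon> k \<omega>))\<^sup>2)) \<omega> \<le> ennreal (\<sigma>\<^sup>2)"
    using noise k by (simp add: sgd_noise_def)
  show "integrable M (\<lambda>\<omega>. (norm (\<epsilon> k \<omega>))\<^sup>2)"
    by (rule integrable_of_nn_cond_exp_le(1)[OF M F meas[OF k] zero_le_power2 bound])
  show "prob_space.expectation M (\<lambda>\<omega>. (norm (\<epsilon> k \<omega>))\<^sup>2) \<le> \<sigma>\<^sup>2"
    by (rule integrable_of_nn_cond_exp_le(2)[OF M F meas[OF k] zero_le_power2 bound])
qed

text \<open>
  The gradient step from \<open>x\<^sub>k\<close> is a function of the history, so the fresh noise contributes its
  second moment and nothing else. This identity serves both for the upper bound and for the
  example that attains it.
\<close>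

lemma sgd_second_moment_step:
  fixes f :: "real ^ 'd \<Rightarrow> real"
  assumes M: "prob_space M" and grad[measurable]: "gradient f \<in> borel_measurable borel"
    and noise: "sgd_noise M N f \<alpha> x0 \<sigma> \<epsilon>" and k: "k < N"
    and step: "\<And>x. (norm (x - \<alpha> *\<^sub>R gradient f x - xstar))\<^sup>2 \<le> c * (norm (x - xstar))\<^sup>2"
    and int: "integrable M (\<lambda>\<omega>. (norm (sgd f \<alpha> x0 \<epsilon> k \<omega> - xstar))\<^sup>2)"
  defines "u \<equiv> \<lambda>\<omega>. sgd f \<alpha> x0 \<epsilon> k \<omega> - \<alpha> *\<^sub>R gradient f (sgd f \<alpha> x0 \<epsilon> k \<omega>) - xstar"
  shows "integrable M (\<lambda>\<omega>. (norm (u \<omega>))\<^sup>2)"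
    and "integrable M (\<lambda>\<omega>. (norm (sgd f \<alpha> x0 \<epsilon> (Suc k) \<omega> - xstar))\<^sup>2)"
    and "prob_space.expectation M (\<lambda>\<omega>. (norm (sgd f \<alpha> x0 \<epsilon> (Suc k) \<omega> - xstar))\<^sup>2)
      = prob_space.expectation M (\<lambda>\<omega>. (norm (u \<omega>))\<^sup>2)
        + \<alpha>\<^sup>2 * prob_space.expectation M (\<lambda>\<omega>. (norm (\<epsilon> k \<omega>))\<^sup>2)"
proof -
  let ?F = "history M (sgd f \<alpha> x0 \<epsilon>) \<epsilon> k"
  note F = sgd_noiseD(1)[OF M grad noise k] and e2 = sgd_noiseD(2)[OF M grad noise k]
  have e: "\<epsilon> k \<in> borel_measurable M" and centered: "AE \<omega> in M. vec_cond_exp M ?F (\<epsilon> k) \<omega> = 0"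
    using noise k by (simp_all add: sgd_noise_def)
  have [measurable]: "sgd f \<alpha> x0 \<epsilon> k \<in> borel_measurable ?F"
    by (rule iterate_history_measurable)
  have u: "u \<in> borel_measurable ?F"
    unfolding u_def by measurable
  have [measurable]: "u \<in> borel_measurable M"
    using F u by (rule measurable_from_subalg)
  show u2: "integrable M (\<lambda>\<omega>. (norm (u \<omega>))\<^sup>2)"
  proof (rule Bochner_Integration.integrable_bound)
    show "integrable M (\<lambda>\<omega>. c * (norm (sgd f \<alpha> x0 \<epsilon> k \<omega> - xstar))\<^sup>2)"
      using int by simp
    show "AE \<omega> in M. norm ((norm (u \<omega>))\<^sup>2) \<le> norm (c * (norm (sgd f \<alpha> x0 \<epsilon> k \<omega> - xstar))\<^sup>2)"
      unfolding u_def real_norm_def abs_power2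
      by (intro AE_I2 order_trans[OF step abs_ge_self])
  qed measurable
  have next_eq: "sgd f \<alpha> x0 \<epsilon> (Suc k) \<omega> - xstar = u \<omega> - \<alpha> *\<^sub>R \<epsilon> k \<omega>" for \<omega>
    by (simp add: u_def algebra_simps)
  show "integrable M (\<lambda>\<omega>. (norm (sgd f \<alpha> x0 \<epsilon> (Suc k) \<omega> - xstar))\<^sup>2)"
    unfolding next_eq by (rule second_moment_add_cond_centered(1)[OF M F u e u2 e2 centered])
  show "prob_space.expectation M (\<lambda>\<omega>. (norm (sgd f \<alpha> x0 \<epsilon> (Suc k) \<omega> - xstar))\<^sup>2)
      = prob_space.expectation M (\<lambda>\<omega>. (norm (u \<omega>))\<^sup>2)
        + \<alpha>\<^sup>2 * prob_space.expectation M (\<lambda>\<omega>. (norm (\<epsilon> k \<omega>))\<^sup>2)"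
    unfolding next_eq by (rule second_moment_add_cond_centered(2)[OF M F u e u2 e2 centered])
qed

lemma geometric_recursion:
  fixes \<phi> :: real
  assumes "\<phi>\<^sup>2 \<noteq> 1"
  shows "\<phi>\<^sup>2 * (\<phi> ^ (2 * k) * a + (1 - \<phi> ^ (2 * k)) / (1 - \<phi>\<^sup>2) * b) + b
    = \<phi> ^ (2 * Suc k) * a + (1 - \<phi> ^ (2 * Suc k)) / (1 - \<phi>\<^sup>2) * b"
proof -
  define p q where "p = \<phi>\<^sup>2" and "q = \<phi> ^ (2 * k)"
  have "\<phi> ^ (2 * Suc k) = p * q"
    by (simp add: p_def q_def power2_eq_square)
  moreover have "p * (q * a + (1 - q) / (1 - p) * b) + b = p * q * a + (1 - p * q) / (1 - p) * b"
    using assms by (simp add: p_def[symmetric] divide_simps) (simp add: algebra_simps)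
  ultimately show ?thesis
    by (simp only: p_def[symmetric] q_def[symmetric])
qed

lemma sgd_second_moment_le:
  fixes f :: "real ^ 'd \<Rightarrow> real"
  assumes M: "prob_space M" and grad: "gradient f \<in> borel_measurable borel"
    and noise: "sgd_noise M N f \<alpha> x0 \<sigma> \<epsilon>" and \<phi>: "\<phi>\<^sup>2 \<noteq> 1"
    and step: "\<And>x. (norm (x - \<alpha> *\<^sub>R gradient f x - xstar))\<^sup>2 \<le> \<phi>\<^sup>2 * (norm (x - xstar))\<^sup>2"
    and "k \<le> N"
  shows "integrable M (\<lambda>\<omega>. (norm (sgd f \<alpha> x0 \<epsilon> k \<omega> - xstar))\<^sup>2) \<and>
    prob_space.expectation M (\<lambda>\<omega>. (norm (sgd f \<alpha> x0 \<epsilon> k \<omega> - xstar))\<^sup>2)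
      \<le> \<phi> ^ (2 * k) * (norm (x0 - xstar))\<^sup>2 + (1 - \<phi> ^ (2 * k)) / (1 - \<phi>\<^sup>2) * (\<alpha>\<^sup>2 * \<sigma>\<^sup>2)"
  using \<open>k \<le> N\<close>
proof (induction k)
  case 0
  interpret prob_space M by fact
  show ?case
    by (simp add: prob_space)
next
  case (Suc k)
  interpret prob_space M by fact
  let ?x = "\<lambda>k \<omega>. (norm (sgd f \<alpha> x0 \<epsilon> k \<omega> - xstar))\<^sup>2"
  let ?u = "\<lambda>\<omega>. sgd f \<alpha> x0 \<epsilon> k \<omega> - \<alpha> *\<^sub>R gradient f (sgd f \<alpha> x0 \<epsilon> k \<omega>) - xstar"
  let ?B = "\<phi> ^ (2 * k) * (norm (x0 - xstar))\<^sup>2 + (1 - \<phi> ^ (2 * k)) / (1 - \<phi>\<^sup>2) * (\<alpha>\<^sup>2 * \<sigma>\<^sup>2)"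
  have k: "k < N" and int: "integrable M (?x k)" and IH: "expectation (?x k) \<le> ?B"
    using Suc by auto
  note one_step = sgd_second_moment_step[OF M grad noise k step int]
  have "expectation (\<lambda>\<omega>. (norm (?u \<omega>))\<^sup>2) \<le> expectation (\<lambda>\<omega>. \<phi>\<^sup>2 * ?x k \<omega>)"
    using one_step(1) int by (intro integral_mono step) auto
  also have "\<dots> \<le> \<phi>\<^sup>2 * ?B"
    using IH by (simp add: mult_left_mono)
  finally have "expectation (\<lambda>\<omega>. (norm (?u \<omega>))\<^sup>2) \<le> \<phi>\<^sup>2 * ?B" .
  moreover have "\<alpha>\<^sup>2 * expectation (\<lambda>\<omega>. (norm (\<epsilon> k \<omega>))\<^sup>2) \<le> \<alpha>\<^sup>2 * \<sigma>\<^sup>2"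
    using sgd_noiseD(3)[OF M grad noise k] by (rule mult_left_mono) simp
  ultimately have "expectation (?x (Suc k)) \<le> \<phi>\<^sup>2 * ?B + \<alpha>\<^sup>2 * \<sigma>\<^sup>2"
    unfolding one_step(3) by (rule add_mono)
  then show ?case
    unfolding geometric_recursion[OF \<phi>] using one_step(2) by blast
qed

lemma sgd_second_moment_eq:
  fixes f :: "real ^ 'd \<Rightarrow> real"
  assumes M: "prob_space M" and grad: "gradient f \<in> borel_measurable borel"
    and noise: "sgd_noise M N f \<alpha> x0 \<sigma> \<epsilon>" and \<phi>: "\<phi>\<^sup>2 \<noteq> 1"
    and step: "\<And>x. (norm (x - \<alpha> *\<^sub>R gradient f x - xstar))\<^sup>2 = \<phi>\<^sup>2 * (norm (x - xstar))\<^sup>2"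
    and full: "\<And>k. k < N \<Longrightarrow> prob_space.expectation M (\<lambda>\<omega>. (norm (\<epsilon> k \<omega>))\<^sup>2) = \<sigma>\<^sup>2"
    and "k \<le> N"
  shows "integrable M (\<lambda>\<omega>. (norm (sgd f \<alpha> x0 \<epsilon> k \<omega> - xstar))\<^sup>2) \<and>
    prob_space.expectation M (\<lambda>\<omega>. (norm (sgd f \<alpha> x0 \<epsilon> k \<omega> - xstar))\<^sup>2)
      = \<phi> ^ (2 * k) * (norm (x0 - xstar))\<^sup>2 + (1 - \<phi> ^ (2 * k)) / (1 - \<phi>\<^sup>2) * (\<alpha>\<^sup>2 * \<sigma>\<^sup>2)"
  using \<open>k \<le> N\<close>
proof (induction k)
  case 0
  interpret prob_space M by fact
  show ?case
    by (simp add: prob_space)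
next
  case (Suc k)
  then have k: "k < N"
    and int: "integrable M (\<lambda>\<omega>. (norm (sgd f \<alpha> x0 \<epsilon> k \<omega> - xstar))\<^sup>2)"
    by auto
  note one_step = sgd_second_moment_step[OF M grad noise k eq_refl[OF step] int]
  show ?case
    using one_step(2,3) Suc k by (simp only: step full geometric_recursion[OF \<phi>, symmetric]) simp
qed

section \<open>Quadratic objective with random signs\<close>

lemma gradient_half_norm_square: "gradient (\<lambda>x. \<mu> / 2 * (norm x)\<^sup>2) = (\<lambda>x. \<mu> *\<^sub>R x)"
  by (rule ext) (rule GDERIV_gradientI[OF GDERIV_half_norm_square])

lemma strongly_convex_half_norm_square: "strongly_convex \<mu> (\<lambda>x. \<mu> / 2 * (norm x)\<^sup>2)"
  by (simp add: strongly_convex_def convex_on_def)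

lemma smooth_half_norm_square:
  fixes \<mu> :: real
  assumes "0 \<le> \<mu>" "\<mu> \<le> L"
  shows "smooth L (\<lambda>x::'a::real_inner. \<mu> / 2 * (norm x)\<^sup>2)"
  unfolding smooth_def gradient_half_norm_square
proof (intro conjI allI)
  show "(\<lambda>x::'a. \<mu> / 2 * (norm x)\<^sup>2) differentiable (at x)" for x
    using GDERIV_half_norm_square[of \<mu> x] unfolding gderiv_def differentiable_def by blast
  show "L-lipschitz_on UNIV (\<lambda>x::'a. \<mu> *\<^sub>R x)"
  proof (rule lipschitz_onI)
    fix x y :: 'a
    have "\<mu> * dist x y \<le> L * dist x y"
      using assms by (intro mult_right_mono) auto
    then show "dist (\<mu> *\<^sub>R x) (\<mu> *\<^sub>R y) \<le> L * dist x y"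
      using assms by (simp add: dist_norm scaleR_diff_right[symmetric])
  qed (use assms in simp)
qed

text \<open>
  Entries from \<open>N\<close> on are zero to keep the support finite. For a uniform distribution on a finite
  set, invariance under a sign change only asks that the sign change permute the set.
\<close>

definition random_signs :: "nat \<Rightarrow> 'a::real_vector \<Rightarrow> (nat \<Rightarrow> 'a) pmf" where
  "random_signs N v = pmf_of_set (PiE_dflt {..<N} 0 (\<lambda>_. {v, - v}))"

definition flip_sign :: "nat \<Rightarrow> (nat \<Rightarrow> 'a::real_vector) \<Rightarrow> nat \<Rightarrow> 'a" where
  "flip_sign k \<omega> = (\<lambda>i. if i = k then - \<omega> i else \<omega> i)"

lemma flip_sign_below: "i < k \<Longrightarrow> flip_sign k \<omega> i = \<omega> i"
  by (simp add: flip_sign_def)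

lemma set_pmf_random_signs:
  "set_pmf (random_signs N v) = PiE_dflt {..<N} 0 (\<lambda>_. {v, - v})"
  unfolding random_signs_def by (rule set_pmf_of_set) (auto intro!: finite_PiE_dflt)

lemma integrable_random_signs:
  fixes g :: "(nat \<Rightarrow> 'a::real_vector) \<Rightarrow> real"
  shows "integrable (random_signs N v) g"
  by (rule integrable_measure_pmf_finite) (auto simp: set_pmf_random_signs intro!: finite_PiE_dflt)

lemma map_pmf_flip_sign_random_signs:
  assumes "k < N"
  shows "map_pmf (flip_sign k) (random_signs N v) = random_signs N v"
  unfolding random_signs_def
proof (rule map_pmf_of_set_bij_betw)
  let ?\<Omega> = "PiE_dflt {..<N} 0 (\<lambda>_. {v, - v})"
  have "flip_sign k \<omega> \<in> ?\<Omega>" if "\<omega> \<in> ?\<Omega>" for \<omega>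
    using that \<open>k < N\<close> by (auto simp: PiE_dflt_def flip_sign_def)
  moreover have "flip_sign k (flip_sign k \<omega>) = \<omega>" for \<omega> :: "nat \<Rightarrow> 'a"
    by (auto simp: flip_sign_def)
  ultimately show "bij_betw (flip_sign k) ?\<Omega> ?\<Omega>"
    by (intro bij_betw_byWitness[where f' = "flip_sign k"]) auto
qed (auto intro!: finite_PiE_dflt)

text \<open>
  The flip leaves every generator of the history unchanged, and the sets that it leaves unchanged
  form a \<open>\<sigma>\<close>-algebra.
\<close>

lemma history_flip_sign_invariant:
  fixes x :: "nat \<Rightarrow> (nat \<Rightarrow> 'a::real_normed_vector) \<Rightarrow> 'a"
  assumes M: "space M = UNIV" and x: "\<And>i \<omega>. i \<le> k \<Longrightarrow> x i (flip_sign k \<omega>) = x i \<omega>"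
    and A: "A \<in> sets (history M x (\<lambda>i \<omega>. \<omega> i) k)"
  shows "flip_sign k \<omega> \<in> A \<longleftrightarrow> \<omega> \<in> A"
proof -
  have "A \<in> sigma_sets UNIV
     ({x i -` B \<inter> UNIV | i B. i \<le> k \<and> B \<in> sets borel} \<union>
      {(\<lambda>\<omega>. \<omega> i) -` B \<inter> UNIV | i B. i < k \<and> B \<in> sets borel})"
    using A sets_measure_of[OF history_generators_subset, of M x k "\<lambda>i \<omega>. \<omega> i"]
    unfolding history_def M by simp
  then show ?thesis
    by (induction arbitrary: \<omega>) (auto simp: x flip_sign_below)
qed

lemma sgd_flip_sign:
  assumes "i \<le> k"
  shows "sgd f \<alpha> x0 (\<lambda>i \<omega>. \<omega> i) i (flip_sign k \<omega>) = sgd f \<alpha> x0 (\<lambda>i \<omega>. \<omega> i) i \<omega>"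
  using assms by (induction i) (auto simp: flip_sign_below)

text \<open>
  Flipping the sign of entry \<open>k\<close> preserves the distribution and every event known at time \<open>k\<close>, but
  negates the noise; hence the noise integrates to zero over each such event.
\<close>

lemma random_signs_cond_centered:
  fixes v :: "real ^ 'd"
  assumes k: "k < N"
  shows "AE \<omega> in random_signs N v.
    vec_cond_exp (random_signs N v)
      (history (random_signs N v) (sgd f \<alpha> x0 (\<lambda>i \<omega>. \<omega> i)) (\<lambda>i \<omega>. \<omega> i) k) (\<lambda>\<omega>. \<omega> k) \<omega> = 0"
proof -
  let ?M = "measure_pmf (random_signs N v)"
  let ?F = "history ?M (sgd f \<alpha> x0 (\<lambda>i \<omega>. \<omega> i)) (\<lambda>i \<omega>. \<omega> i) k"
  interpret finite_measure_subalgebra ?M ?F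
    by unfold_locales (auto intro!: history_subalgebra)
  have zero: "(\<integral>\<omega>\<in>A. \<omega> k $ j \<partial>?M) = 0" if A: "A \<in> sets ?F" for A j
  proof -
    have inv: "flip_sign k \<omega> \<in> A \<longleftrightarrow> \<omega> \<in> A" for \<omega>
      by (rule history_flip_sign_invariant[OF _ sgd_flip_sign A]) auto
    have "(\<integral>\<omega>\<in>A. \<omega> k $ j \<partial>?M)
        = (\<integral>\<omega>. indicator A \<omega> *\<^sub>R (\<omega> k $ j) \<partial>map_pmf (flip_sign k) (random_signs N v))"
      by (simp only: set_lebesgue_integral_def map_pmf_flip_sign_random_signs[OF k])
    also have "\<dots> = (\<integral>\<omega>. - (indicator A \<omega> *\<^sub>R (\<omega> k $ j)) \<partial>?M)"
      unfolding integral_map_pmf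
      by (rule Bochner_Integration.integral_cong) (simp_all add: indicator_def inv, simp add: flip_sign_def)
    also have "\<dots> = - (\<integral>\<omega>\<in>A. \<omega> k $ j \<partial>?M)"
      by (simp add: set_lebesgue_integral_def)
    finally show ?thesis
      by simp
  qed
  have "AE \<omega> in ?M. real_cond_exp ?M ?F (\<lambda>\<omega>. \<omega> k $ j) \<omega> = 0" for j
    by (rule real_cond_exp_charact)
       (auto simp: zero set_lebesgue_integral_def[where f = "\<lambda>_. 0"] integrable_random_signs)
  then have "AE \<omega> in ?M. \<forall>j\<in>UNIV. real_cond_exp ?M ?F (\<lambda>\<omega>. \<omega> k $ j) \<omega> = 0"
    by (intro AE_finite_allI) auto
  then show ?thesis
    by eventually_elim (simp add: vec_cond_exp_def vec_eq_iff)
qed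

lemma norm_random_signs:
  fixes v :: "'a::real_normed_vector"
  assumes "k < N" "\<omega> \<in> set_pmf (random_signs N v)"
  shows "norm (\<omega> k) = norm v"
  using assms by (fastforce simp: set_pmf_random_signs PiE_dflt_def)

lemma random_signs_sgd_noise:
  fixes v :: "real ^ 'd"
  assumes v: "(norm v)\<^sup>2 = \<sigma>\<^sup>2"
  shows "sgd_noise (random_signs N v) N f \<alpha> x0 \<sigma> (\<lambda>i \<omega>. \<omega> i)"
  unfolding sgd_noise_def
proof (intro allI impI conjI)
  fix k assume k: "k < N"
  let ?M = "measure_pmf (random_signs N v)"
  let ?F = "history ?M (sgd f \<alpha> x0 (\<lambda>i \<omega>. \<omega> i)) (\<lambda>i \<omega>. \<omega> i) k"
  interpret finite_measure_subalgebra ?M ?F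
    by unfold_locales (auto intro!: history_subalgebra)
  show "(\<lambda>\<omega>. \<omega> k) \<in> borel_measurable ?M"
    by simp
  show "AE \<omega> in ?M. vec_cond_exp ?M ?F (\<lambda>\<omega>. \<omega> k) \<omega> = 0"
    by (rule random_signs_cond_centered[OF k])
  have "AE \<omega> in ?M. nn_cond_exp ?M ?F (\<lambda>\<omega>. ennreal ((norm (\<omega> k))\<^sup>2)) \<omega>
      = nn_cond_exp ?M ?F (\<lambda>_. ennreal (\<sigma>\<^sup>2)) \<omega>"
    by (rule nn_cond_exp_cong) (auto simp: AE_measure_pmf_iff norm_random_signs[OF k] v)
  moreover have "AE \<omega> in ?M. ennreal (\<sigma>\<^sup>2) = nn_cond_exp ?M ?F (\<lambda>_. ennreal (\<sigma>\<^sup>2)) \<omega>"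
    by (rule nn_cond_exp_F_meas) simp
  ultimately show "AE \<omega> in ?M. nn_cond_exp ?M ?F (\<lambda>\<omega>. ennreal ((norm (\<omega> k))\<^sup>2)) \<omega> \<le> ennreal (\<sigma>\<^sup>2)"
    by eventually_elim simp
qed

lemma random_signs_second_moment:
  fixes v :: "'a::real_normed_vector"
  assumes "k < N"
  shows "measure_pmf.expectation (random_signs N v) (\<lambda>\<omega>. (norm (\<omega> k))\<^sup>2) = (norm v)\<^sup>2"
proof -
  have "measure_pmf.expectation (random_signs N v) (\<lambda>\<omega>. (norm (\<omega> k))\<^sup>2)
      = measure_pmf.expectation (random_signs N v) (\<lambda>\<omega>. (norm v)\<^sup>2)"
    by (rule integral_cong_AE) (auto simp: AE_measure_pmf_iff norm_random_signs[OF assms])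
  then show ?thesis
    by simp
qed

section \<open>The bound and its tightness\<close>

theorem theorem1:
  fixes N :: nat and \<mu> L \<sigma> \<alpha> \<phi> :: real and x0 :: "real ^ 'd"
  assumes "0 < \<mu>" and "\<mu> < L" and "\<sigma>\<^sup>2 \<ge> 0" and "\<alpha> \<in> {0<..2 / (L + \<mu>)}"
    and "\<phi> = 1 - \<mu> * \<alpha>"
  shows
    "(\<forall>(f :: real ^ 'd \<Rightarrow> real) xstar (M :: 'w measure) \<epsilon>.
        strongly_convex \<mu> f \<and> smooth L f \<and> (\<forall>y. f xstar \<le> f y) \<and>
        prob_space M \<and> sgd_noise M N f \<alpha> x0 \<sigma> \<epsilon> \<longrightarrow>
        integrable M (\<lambda>\<omega>. (norm (sgd f \<alpha> x0 \<epsilon> N \<omega> - xstar))\<^sup>2) \<and>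
        prob_space.expectation M (\<lambda>\<omega>. (norm (sgd f \<alpha> x0 \<epsilon> N \<omega> - xstar))\<^sup>2)
          \<le> \<phi> ^ (2 * N) * (norm (x0 - xstar))\<^sup>2
            + (1 - \<phi> ^ (2 * N)) / (1 - \<phi>\<^sup>2) * \<alpha>\<^sup>2 * \<sigma>\<^sup>2)
     \<and>
     (\<exists>(f :: real ^ 'd \<Rightarrow> real) xstar (M :: (nat \<Rightarrow> real ^ 'd) measure) \<epsilon>.
        strongly_convex \<mu> f \<and> smooth L f \<and> (\<forall>y. f xstar \<le> f y) \<and>
        prob_space M \<and> sgd_noise M N f \<alpha> x0 \<sigma> \<epsilon> \<and>
        integrable M (\<lambda>\<omega>. (norm (sgd f \<alpha> x0 \<epsilon> N \<omega> - xstar))\<^sup>2) \<and>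
        prob_space.expectation M (\<lambda>\<omega>. (norm (sgd f \<alpha> x0 \<epsilon> N \<omega> - xstar))\<^sup>2)
          = \<phi> ^ (2 * N) * (norm (x0 - xstar))\<^sup>2
            + (1 - \<phi> ^ (2 * N)) / (1 - \<phi>\<^sup>2) * \<alpha>\<^sup>2 * \<sigma>\<^sup>2)"
proof -
  have \<alpha>: "0 < \<alpha>" "\<alpha> \<le> 2 / (L + \<mu>)"
    using assms(4) by auto
  \<comment> \<open>\<open>0 < \<phi> < 1\<close>, so the denominator \<open>1 - \<phi>\<^sup>2\<close> of the geometric sum does not vanish\<close>
  have "(L + \<mu>) * \<alpha> \<le> 2"
    using \<alpha> assms(1,2) by (simp add: field_simps)
  moreover have "2 * (\<mu> * \<alpha>) < (L + \<mu>) * \<alpha>"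
    using \<alpha> assms(2) by (simp add: distrib_right)
  ultimately have "\<mu> * \<alpha> < 1"
    by linarith
  then have "0 < \<phi>" "\<phi> < 1"
    using mult_pos_pos[OF assms(1) \<alpha>(1)] unfolding assms(5) by linarith+
  then have \<phi>: "\<phi>\<^sup>2 \<noteq> 1"
    by (auto simp: power2_eq_1_iff)
  show ?thesis
  proof (intro conjI allI impI)
    fix f :: "real ^ 'd \<Rightarrow> real" and xstar and M :: "'w measure" and \<epsilon>
    assume "strongly_convex \<mu> f \<and> smooth L f \<and> (\<forall>y. f xstar \<le> f y) \<and>
      prob_space M \<and> sgd_noise M N f \<alpha> x0 \<sigma> \<epsilon>"
    then have f: "strongly_convex \<mu> f" "smooth L f" "\<forall>y. f xstar \<le> f y"
      and M: "prob_space M" and noise: "sgd_noise M N f \<alpha> x0 \<sigma> \<epsilon>"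
      by auto
    have step: "(norm (x - \<alpha> *\<^sub>R gradient f x - xstar))\<^sup>2 \<le> \<phi>\<^sup>2 * (norm (x - xstar))\<^sup>2" for x
      unfolding assms(5) by (rule gradient_step_contraction[OF assms(1,2) \<alpha> f])
    note bound = sgd_second_moment_le[OF M smooth_gradient_measurable[OF f(2)] noise \<phi> step order_refl]
    show "integrable M (\<lambda>\<omega>. (norm (sgd f \<alpha> x0 \<epsilon> N \<omega> - xstar))\<^sup>2)"
      using bound by blast
    show "prob_space.expectation M (\<lambda>\<omega>. (norm (sgd f \<alpha> x0 \<epsilon> N \<omega> - xstar))\<^sup>2)
      \<le> \<phi> ^ (2 * N) * (norm (x0 - xstar))\<^sup>2 + (1 - \<phi> ^ (2 * N)) / (1 - \<phi>\<^sup>2) * \<alpha>\<^sup>2 * \<sigma>\<^sup>2"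
      using bound by (simp add: mult.assoc)
  next
    define f :: "real ^ 'd \<Rightarrow> real" where "f = (\<lambda>x. \<mu> / 2 * (norm x)\<^sup>2)"
    define v :: "real ^ 'd" where "v = axis undefined \<sigma>"
    let ?M = "measure_pmf (random_signs N v)" and ?\<epsilon> = "\<lambda>i \<omega> :: nat \<Rightarrow> real ^ 'd. \<omega> i"
    have v: "(norm v)\<^sup>2 = \<sigma>\<^sup>2"
      unfolding v_def power2_norm_eq_inner inner_axis_axis by (simp add: power2_eq_square)
    have grad: "gradient f = (\<lambda>x. \<mu> *\<^sub>R x)"
      unfolding f_def by (rule gradient_half_norm_square)
    have sc: "strongly_convex \<mu> f"
      unfolding f_def by (rule strongly_convex_half_norm_square)
    have sm: "smooth L f"
      unfolding f_def using assms(1,2) by (intro smooth_half_norm_square) auto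
    have min: "\<forall>y. f 0 \<le> f y"
      using assms(1) by (simp add: f_def)
    have noise: "sgd_noise ?M N f \<alpha> x0 \<sigma> ?\<epsilon>"
      by (rule random_signs_sgd_noise[OF v])
    have step: "(norm (x - \<alpha> *\<^sub>R gradient f x - 0))\<^sup>2 = \<phi>\<^sup>2 * (norm (x - 0))\<^sup>2" for x
    proof -
      have "x - \<alpha> *\<^sub>R gradient f x = \<phi> *\<^sub>R x"
        by (simp add: grad assms(5) algebra_simps)
      then show ?thesis
        by (simp add: power_mult_distrib)
    qed
    have full: "measure_pmf.expectation (random_signs N v) (\<lambda>\<omega>. (norm (?\<epsilon> k \<omega>))\<^sup>2) = \<sigma>\<^sup>2"
      if "k < N" for k
      by (rule trans[OF random_signs_second_moment[OF that] v])
    note exact = sgd_second_moment_eq[OF measure_pmf.prob_space_axioms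
        smooth_gradient_measurable[OF sm] noise \<phi> step full order_refl]
    show "\<exists>(f :: real ^ 'd \<Rightarrow> real) xstar (M :: (nat \<Rightarrow> real ^ 'd) measure) \<epsilon>.
        strongly_convex \<mu> f \<and> smooth L f \<and> (\<forall>y. f xstar \<le> f y) \<and>
        prob_space M \<and> sgd_noise M N f \<alpha> x0 \<sigma> \<epsilon> \<and>
        integrable M (\<lambda>\<omega>. (norm (sgd f \<alpha> x0 \<epsilon> N \<omega> - xstar))\<^sup>2) \<and>
        prob_space.expectation M (\<lambda>\<omega>. (norm (sgd f \<alpha> x0 \<epsilon> N \<omega> - xstar))\<^sup>2)
          = \<phi> ^ (2 * N) * (norm (x0 - xstar))\<^sup>2
            + (1 - \<phi> ^ (2 * N)) / (1 - \<phi>\<^sup>2) * \<alpha>\<^sup>2 * \<sigma>\<^sup>2"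
      using sc sm min noise exact measure_pmf.prob_space_axioms[of "random_signs N v"]
      by (intro exI[of _ f] exI[of _ 0] exI[of _ ?M] exI[of _ ?\<epsilon>]) (simp add: mult.assoc)
  qed
qed

end
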